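(* Let $r\le s$ and $m\ge 1$ be integers with $m<\frac r2$. Let $\mathcal{KT}_{r,s,m}$ be the family of signed complete bipartite graphs $(K_{r,s},T_m^-)$ whose negative edges induce a tree $T_m$ with $m$ edges. If $(K_{r,s},{T_m^*}^-)$ maximizes the index among all signed graphs in $\mathcal{KT}_{r,s,m}$, then $T_m^*$ is isomorphic to $D_{m,1}$.
   Context: Graphs are finite and simple. A signed graph $\dot G$ is a graph $G$ together with a sign $\sigma(e)\in\{-1,1\}$ for each edge $e$; we write $\dot G=(G,H^-)$, where $H$ is the subgraph of $G$ formed by the negative edges and their endpoints (so $H$ has no isolated vertices). The adjacency matrix $A(\dot G)$ has $ij$-entry $\sigma(ij)$ if $ij$ is an edge and $0$ otherwise. The index $\lambda_1(\dot G)$ is the largest eigenvalue of $A(\dot G)$. $K_{r,s}$ is the complete bipartite graph with parts $X=\{v_1,\dots,v_r\}$ and $Y=\{w_1,\dots,w_s\}$. $D_{i,j}$ denotes the star or double star in $K_{r,s}$ with vertex set $\{v_1,\dots,v_i,w_1,\dots,w_j\}$ and centers $v_1$ and $w_1$, i.e. with edges $v_1w_b$ ($1\le b\le j$) and $v_aw_1$ ($1\le a\le i$); in particular $D_{m,1}$ is the star with $m$ edges centered at $w_1$. *)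

theory Defs
  imports "Jordan_Normal_Form.Spectral_Radius"
begin

record 'a ugraph =
  verts :: "'a set"
  edges :: "'a set set"

definition simple_graph :: "'a ugraph \<Rightarrow> bool" where
  "simple_graph G \<longleftrightarrow> finite (verts G) \<and> (\<forall>e \<in> edges G. e \<subseteq> verts G \<and> card e = 2)"

definition connected_graph :: "'a ugraph \<Rightarrow> bool" where
  "connected_graph G \<longleftrightarrow> verts G \<noteq> {} \<and>
     (\<forall>u \<in> verts G. \<forall>v \<in> verts G. (u, v) \<in> {(x, y). {x, y} \<in> edges G}\<^sup>*)"

definition is_cycle :: "'a ugraph \<Rightarrow> 'a list \<Rightarrow> bool" where
  "is_cycle G c \<longleftrightarrow> 3 \<le> length c \<and> distinct c \<and>
     (\<forall>i < length c. {c ! i, c ! (Suc i mod length c)} \<in> edges G)"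

definition is_tree :: "'a ugraph \<Rightarrow> bool" where
  "is_tree G \<longleftrightarrow> simple_graph G \<and> connected_graph G \<and> (\<nexists>c. is_cycle G c)"

definition graph_iso :: "'a ugraph \<Rightarrow> 'b ugraph \<Rightarrow> bool" where
  "graph_iso G H \<longleftrightarrow> (\<exists>f. bij_betw f (verts G) (verts H) \<and>
     (\<forall>u \<in> verts G. \<forall>v \<in> verts G. {u, v} \<in> edges G \<longleftrightarrow> {f u, f v} \<in> edges H))"

text \<open>Signs of non-edges carry no information and are never inspected.\<close>

record 'a signed_graph =
  graph :: "'a ugraph"
  sign :: "'a set \<Rightarrow> int"

definition is_signed_graph :: "'a signed_graph \<Rightarrow> bool" where
  "is_signed_graph S \<longleftrightarrow> simple_graph (graph S) \<and> (\<forall>e \<in> edges (graph S). sign S e \<in> {-1, 1})"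

definition negative_subgraph :: "'a signed_graph \<Rightarrow> 'a ugraph" where
  "negative_subgraph S =
     (let N = {e \<in> edges (graph S). sign S e = -1} in \<lparr>verts = \<Union>N, edges = N\<rparr>)"

text \<open>The rows and columns of a matrix are numbered from 0, so the adjacency matrix is
  meaningful for graphs whose vertex set is an initial segment of the natural numbers.\<close>

definition adjacency_matrix :: "nat signed_graph \<Rightarrow> real mat" where
  "adjacency_matrix S = (let n = card (verts (graph S)) in
     mat n n (\<lambda>(i, j). if {i, j} \<in> edges (graph S) then of_int (sign S {i, j}) else 0))"

text \<open>The matrix is real and symmetric, so all its eigenvalues are real and it does no harm to
  take the spectrum over the reals.\<close>

definition index :: "nat signed_graph \<Rightarrow> real" where
  "index S = Max (spectrum (adjacency_matrix S))"

text \<open>In the complete bipartite graph with parts of sizes \<open>r\<close> and \<open>s\<close>, the vertices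
  \<open>v\<^sub>1, \<dots>, v\<^sub>r\<close> are \<open>0, \<dots>, r - 1\<close> and the vertices \<open>w\<^sub>1, \<dots>, w\<^sub>s\<close> are \<open>r, \<dots>, r + s - 1\<close>.\<close>

definition complete_bipartite :: "nat \<Rightarrow> nat \<Rightarrow> nat ugraph" where
  "complete_bipartite r s = \<lparr>verts = {..<r + s}, edges = {{a, r + b} | a b. a < r \<and> b < s}\<rparr>"

text \<open>The centers \<open>v\<^sub>1\<close> and \<open>w\<^sub>1\<close> are the vertices \<open>0\<close> and \<open>r\<close>.\<close>

definition double_star :: "nat \<Rightarrow> nat \<Rightarrow> nat \<Rightarrow> nat ugraph" where
  "double_star r i j =
     \<lparr>verts = {..<i} \<union> {r..<r + j},
      edges = {{0, r + b} | b. b < j} \<union> {{a, r} | a. a < i}\<rparr>"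

definition KT :: "nat \<Rightarrow> nat \<Rightarrow> nat \<Rightarrow> nat signed_graph set" where
  "KT r s m = {S. is_signed_graph S \<and> graph S = complete_bipartite r s \<and>
     is_tree (negative_subgraph S) \<and> card (edges (negative_subgraph S)) = m}"

end

theory Submission imports Defs begin

text \<open>
Let $B$ be the $r \times s$ matrix of signs, $C = B B^T$ and $t = rs$ its trace. The square $\mu$ of the
index is the largest eigenvalue of $C$. It is decided by the number $\mu (t - \mu)$: this decreases
for $\mu \ge t/2$, and the star satisfies $\mu \ge t/2$, so a graph with an index at least that of the
star has $\mu (t - \mu)$ at most that of the star.

For the star with $m$ edges centred at $w_1$, the matrix $C$ has rank 2 and
$\mu (t - \mu) = 4m(r - m)(s - 1)$ exactly (\<open>star_eigenvalue\<close>). For an arbitrary signed graph with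
$\mu \ge t/2$, the number $\mu (t - \mu)$ is bounded below by the value of the quadratic form
$t C - C^2$ at any unit vector (\<open>gram_quadratic_bound\<close>). At the normalised all-ones vector this value
is a polynomial in the degrees of the negative edges, and as soon as two negative edges are disjoint
it is larger than $4m(r - m)(s - 1)$, the excess being at least $4(s - 4)$ times the number of
ordered pairs of disjoint negative edges (\<open>disjoint_edges_bound\<close>); here $s > 4$, because $m \ge 2$
and $s \ge r > 2m$. So two disjoint negative edges make the index smaller than that of the star.

In a maximiser any two negative edges therefore share an endpoint. Since the graph is bipartite, they
then all share one endpoint, and the negative edges form a star. Its centre may lie in either part:
for the isomorphism type this makes no difference.
\<close>

section \<open>Quadratic forms of a Gram matrix\<close>

text \<open>Bessel's inequality for the orthogonal system \<open>x, v\<close>, with the denominators cleared so that it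
also covers the case where one of the two vectors vanishes.\<close>

lemma bessel_two:
  fixes b x v :: "'i \<Rightarrow> real"
  assumes "finite I" and orth: "(\<Sum>i\<in>I. x i * v i) = 0"
  shows "(\<Sum>i\<in>I. b i * v i)\<^sup>2 * (\<Sum>i\<in>I. (x i)\<^sup>2) + (\<Sum>i\<in>I. b i * x i)\<^sup>2 * (\<Sum>i\<in>I. (v i)\<^sup>2)
    \<le> (\<Sum>i\<in>I. (b i)\<^sup>2) * (\<Sum>i\<in>I. (x i)\<^sup>2) * (\<Sum>i\<in>I. (v i)\<^sup>2)"
proof -
  define n where "n = (\<Sum>i\<in>I. (x i)\<^sup>2)"
  define V where "V = (\<Sum>i\<in>I. (v i)\<^sup>2)"
  define \<beta> where "\<beta> = (\<Sum>i\<in>I. b i * x i)"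
  define \<gamma> where "\<gamma> = (\<Sum>i\<in>I. b i * v i)"
  define q where "q = (\<Sum>i\<in>I. (b i)\<^sup>2)"
  have n0: "n \<ge> 0" and V0: "V \<ge> 0"
    by (simp_all add: n_def V_def sum_nonneg)
  consider "n = 0" | "V = 0" | "n > 0" "V > 0"
    using n0 V0 by linarith
  then have "\<gamma>\<^sup>2 * n + \<beta>\<^sup>2 * V \<le> q * n * V"
  proof cases
    case 1
    then have "\<forall>i\<in>I. x i = 0"
      using assms(1) by (simp add: n_def sum_nonneg_eq_0_iff)
    then have "\<beta> = 0" by (simp add: \<beta>_def)
    with 1 show ?thesis by simp
  next
    case 2
    then have "\<forall>i\<in>I. v i = 0"
      using assms(1) by (simp add: V_def sum_nonneg_eq_0_iff)
    then have "\<gamma> = 0" by (simp add: \<gamma>_def)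
    with 2 show ?thesis by simp
  next
    case 3
    \<comment> \<open>the residual of the projection of \<open>b\<close> onto the span of \<open>x\<close> and \<open>v\<close>, scaled by \<open>n * V\<close>\<close>
    have "0 \<le> (\<Sum>i\<in>I. (n * V * b i - \<beta> * V * x i - \<gamma> * n * v i)\<^sup>2)"
      by (intro sum_nonneg) simp
    also have "\<dots> = (\<Sum>i\<in>I. (n * V)\<^sup>2 * (b i)\<^sup>2 + (\<beta> * V)\<^sup>2 * (x i)\<^sup>2 + (\<gamma> * n)\<^sup>2 * (v i)\<^sup>2
        - 2 * n * V * \<beta> * V * (b i * x i) - 2 * n * V * \<gamma> * n * (b i * v i)
        + 2 * \<beta> * V * \<gamma> * n * (x i * v i))"
      by (intro sum.cong refl) (simp add: power2_eq_square algebra_simps)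
    also have "\<dots> = (n * V)\<^sup>2 * q + (\<beta> * V)\<^sup>2 * n + (\<gamma> * n)\<^sup>2 * V
        - 2 * n * V * \<beta> * V * \<beta> - 2 * n * V * \<gamma> * n * \<gamma>"
      using orth
      by (simp add: sum.distrib sum_subtractf sum_distrib_left[symmetric] n_def V_def \<beta>_def \<gamma>_def q_def)
    also have "\<dots> = (n * V) * (q * n * V - (\<gamma>\<^sup>2 * n + \<beta>\<^sup>2 * V))"
      by (simp add: power2_eq_square algebra_simps)
    finally have "0 \<le> (n * V) * (q * n * V - (\<gamma>\<^sup>2 * n + \<beta>\<^sup>2 * V))" .
    moreover have "0 < n * V" using 3 by simp
    ultimately show ?thesis
      by (metis diff_ge_0_iff_ge zero_le_mult_iff not_less)
  qed
  then show ?thesis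
    by (simp add: n_def V_def \<beta>_def \<gamma>_def q_def)
qed

text \<open>Below, \<open>col_prod I B z\<close> is the vector $B^T z$ and \<open>gram I J B z\<close> is $B B^T z$. They are functions on
arbitrary finite index sets, which keeps the estimates free of matrix dimensions.\<close>

definition col_prod :: "'i set \<Rightarrow> ('i \<Rightarrow> 'j \<Rightarrow> real) \<Rightarrow> ('i \<Rightarrow> real) \<Rightarrow> 'j \<Rightarrow> real" where
  "col_prod I B z j = (\<Sum>i\<in>I. B i j * z i)"

definition gram :: "'i set \<Rightarrow> 'j set \<Rightarrow> ('i \<Rightarrow> 'j \<Rightarrow> real) \<Rightarrow> ('i \<Rightarrow> real) \<Rightarrow> 'i \<Rightarrow> real" where
  "gram I J B z i = (\<Sum>j\<in>J. B i j * col_prod I B z j)"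

lemma col_prod_linear:
  "col_prod I B (\<lambda>i. a * x i + v i) j = a * col_prod I B x j + col_prod I B v j"
  by (simp add: col_prod_def algebra_simps sum.distrib sum_distrib_left)

lemma gram_linear:
  "gram I J B (\<lambda>i. a * x i + v i) i = a * gram I J B x i + gram I J B v i"
  unfolding gram_def col_prod_linear by (simp add: algebra_simps sum.distrib sum_distrib_left)

lemma gram_adjoint:
  "(\<Sum>i\<in>I. w i * gram I J B z i) = (\<Sum>j\<in>J. col_prod I B w j * col_prod I B z j)"
proof -
  have "(\<Sum>i\<in>I. w i * gram I J B z i) = (\<Sum>i\<in>I. \<Sum>j\<in>J. (B i j * w i) * col_prod I B z j)"
    by (simp add: gram_def sum_distrib_left mult_ac)
  also have "\<dots> = (\<Sum>j\<in>J. \<Sum>i\<in>I. (B i j * w i) * col_prod I B z j)"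
    by (rule sum.swap)
  finally show ?thesis
    by (simp add: col_prod_def[of I B w] sum_distrib_right)
qed

text \<open>Let $C = B B^T$, let $t$ be its trace and $\mu$ an eigenvalue with $\mu \ge t/2$. The other
eigenvalues are nonnegative and have sum $t - \mu$, so each of them lies between $0$ and
$t - \mu \le t/2$, where $\nu \mapsto \nu (t - \nu)$ is increasing. Hence the quadratic form
$t C - C^2$ is at most $\mu (t - \mu)$ on unit vectors, and any test vector $z$ gives a lower bound
on $\mu (t - \mu)$. The proof makes this concrete by splitting $z$ into a multiple of the
eigenvector $x$ and an orthogonal part $v$; on $v$ it rests on $C \le t - \mu$, which is Bessel's
inequality for the columns of $B$.\<close>

lemma gram_quadratic_bound:
  fixes B :: "'i \<Rightarrow> 'j \<Rightarrow> real"
  assumes fin: "finite I"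
    and eig: "\<And>i. i \<in> I \<Longrightarrow> gram I J B x i = \<mu> * x i"
    and x0: "0 < (\<Sum>i\<in>I. (x i)\<^sup>2)"
    and t: "t = (\<Sum>j\<in>J. \<Sum>i\<in>I. (B i j)\<^sup>2)"
    and big: "t \<le> 2 * \<mu>"
  shows "t * (\<Sum>j\<in>J. (col_prod I B z j)\<^sup>2) - (\<Sum>i\<in>I. (gram I J B z i)\<^sup>2)
    \<le> \<mu> * (t - \<mu>) * (\<Sum>i\<in>I. (z i)\<^sup>2)"
proof -
  define n where "n = (\<Sum>i\<in>I. (x i)\<^sup>2)"
  define \<alpha> where "\<alpha> = (\<Sum>i\<in>I. x i * z i) / n"
  define v where "v = (\<lambda>i. z i - \<alpha> * x i)"
  define \<kappa> where "\<kappa> = t - \<mu>"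
  define V where "V = (\<Sum>i\<in>I. (v i)\<^sup>2)"
  define W where "W = (\<Sum>j\<in>J. (col_prod I B v j)\<^sup>2)"
  define G where "G = (\<Sum>i\<in>I. (gram I J B v i)\<^sup>2)"
  have n0: "n > 0" using x0 by (simp add: n_def)
  have z: "z = (\<lambda>i. \<alpha> * x i + v i)" by (simp add: v_def)
  have orth: "(\<Sum>i\<in>I. x i * v i) = 0"
  proof -
    have "(\<Sum>i\<in>I. x i * v i) = (\<Sum>i\<in>I. x i * z i) - \<alpha> * n"
      by (simp add: v_def n_def algebra_simps sum_subtractf sum_distrib_left power2_eq_square)
    then show ?thesis using n0 by (simp add: \<alpha>_def)
  qed
  have vx: "(\<Sum>i\<in>I. v i * gram I J B x i) = 0"
  proof -
    have "(\<Sum>i\<in>I. v i * gram I J B x i) = (\<Sum>i\<in>I. \<mu> * (x i * v i))"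
      by (intro sum.cong refl) (simp add: eig mult_ac)
    then show ?thesis using orth by (simp add: sum_distrib_left[symmetric])
  qed
  then have cross: "(\<Sum>j\<in>J. col_prod I B x j * col_prod I B v j) = 0"
    using gram_adjoint[where w = v and z = x and I = I and J = J and B = B] by (simp add: mult.commute)
  then have cross': "(\<Sum>i\<in>I. x i * gram I J B v i) = 0"
    using gram_adjoint[where w = x and z = v and I = I and J = J and B = B] by simp
  have xx: "(\<Sum>j\<in>J. (col_prod I B x j)\<^sup>2) = \<mu> * n"
  proof -
    have "(\<Sum>j\<in>J. (col_prod I B x j)\<^sup>2) = (\<Sum>i\<in>I. x i * gram I J B x i)"
      by (simp add: gram_adjoint power2_eq_square)
    also have "\<dots> = (\<Sum>i\<in>I. \<mu> * (x i)\<^sup>2)"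
      by (intro sum.cong refl) (simp add: eig power2_eq_square)
    finally show ?thesis by (simp add: n_def sum_distrib_left)
  qed
  have vv: "(\<Sum>i\<in>I. v i * gram I J B v i) = W"
    by (simp add: gram_adjoint W_def power2_eq_square)
  have zz: "(\<Sum>i\<in>I. (z i)\<^sup>2) = \<alpha>\<^sup>2 * n + V"
  proof -
    have "(\<Sum>i\<in>I. (z i)\<^sup>2) = (\<Sum>i\<in>I. \<alpha>\<^sup>2 * (x i)\<^sup>2 + (v i)\<^sup>2 + 2 * \<alpha> * (x i * v i))"
      by (intro sum.cong refl) (simp add: z power2_eq_square algebra_simps)
    then show ?thesis
      by (simp add: sum.distrib sum_distrib_left[symmetric] orth n_def V_def)
  qed
  have cz: "(\<Sum>j\<in>J. (col_prod I B z j)\<^sup>2) = \<alpha>\<^sup>2 * (\<mu> * n) + W"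
  proof -
    have "(\<Sum>j\<in>J. (col_prod I B z j)\<^sup>2) = (\<Sum>j\<in>J. \<alpha>\<^sup>2 * (col_prod I B x j)\<^sup>2
        + (col_prod I B v j)\<^sup>2 + 2 * \<alpha> * (col_prod I B x j * col_prod I B v j))"
      unfolding z col_prod_linear by (intro sum.cong refl) (simp add: power2_eq_square algebra_simps)
    then show ?thesis
      by (simp add: sum.distrib sum_distrib_left[symmetric] cross xx W_def)
  qed
  have gz: "(\<Sum>i\<in>I. (gram I J B z i)\<^sup>2) = \<alpha>\<^sup>2 * \<mu>\<^sup>2 * n + G"
  proof -
    have "(\<Sum>i\<in>I. (gram I J B z i)\<^sup>2) = (\<Sum>i\<in>I. \<alpha>\<^sup>2 * \<mu>\<^sup>2 * (x i)\<^sup>2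
        + (gram I J B v i)\<^sup>2 + 2 * \<alpha> * \<mu> * (x i * gram I J B v i))"
      unfolding z gram_linear by (intro sum.cong refl) (simp add: eig power2_eq_square algebra_simps)
    then show ?thesis
      by (simp add: sum.distrib sum_distrib_left[symmetric] cross' n_def G_def)
  qed
  \<comment> \<open>no column of \<open>B\<close> has more weight on \<open>x\<close> and \<open>v\<close> together than its own square norm\<close>
  have WV: "W \<le> \<kappa> * V"
  proof -
    have "W * n + (\<mu> * n) * V = W * n + (\<Sum>j\<in>J. (col_prod I B x j)\<^sup>2) * V"
      by (simp only: xx)
    also have "\<dots> = (\<Sum>j\<in>J. (\<Sum>i\<in>I. B i j * v i)\<^sup>2 * (\<Sum>i\<in>I. (x i)\<^sup>2)
        + (\<Sum>i\<in>I. B i j * x i)\<^sup>2 * (\<Sum>i\<in>I. (v i)\<^sup>2))"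
      unfolding W_def n_def V_def col_prod_def by (simp add: sum.distrib sum_distrib_right)
    also have "\<dots> \<le> (\<Sum>j\<in>J. (\<Sum>i\<in>I. (B i j)\<^sup>2) * (\<Sum>i\<in>I. (x i)\<^sup>2) * (\<Sum>i\<in>I. (v i)\<^sup>2))"
      by (intro sum_mono bessel_two fin orth)
    also have "\<dots> = t * n * V"
      by (simp add: t n_def V_def sum_distrib_right)
    finally have "n * W \<le> n * (\<kappa> * V)"
      by (simp add: \<kappa>_def algebra_simps)
    then show ?thesis using n0 by simp
  qed
  \<comment> \<open>on \<open>v\<close>: $(\mu - C)(\kappa - C) = (\kappa - C)^2 + (\mu - \kappa)(\kappa - C)$, both summands being positive semidefinite\<close>
  have "0 \<le> (\<Sum>i\<in>I. (\<kappa> * v i - gram I J B v i)\<^sup>2)"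
    by (intro sum_nonneg) simp
  also have "\<dots> = (\<Sum>i\<in>I. \<kappa>\<^sup>2 * (v i)\<^sup>2 - 2 * \<kappa> * (v i * gram I J B v i) + (gram I J B v i)\<^sup>2)"
    by (intro sum.cong refl) (simp add: power2_eq_square algebra_simps)
  also have "\<dots> = \<kappa>\<^sup>2 * V - 2 * \<kappa> * W + G"
    by (simp add: sum.distrib sum_subtractf sum_distrib_left[symmetric] vv V_def G_def)
  finally have sq: "0 \<le> \<kappa>\<^sup>2 * V - 2 * \<kappa> * W + G" .
  have "0 \<le> (\<mu> - \<kappa>) * (\<kappa> * V - W)"
    using WV big by (intro mult_nonneg_nonneg) (auto simp: \<kappa>_def)
  with sq have "(\<mu> + \<kappa>) * W - G \<le> \<mu> * \<kappa> * V"
    by (simp add: power2_eq_square algebra_simps)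
  then have "t * W - G \<le> \<mu> * (t - \<mu>) * V"
    by (simp add: \<kappa>_def)
  then show ?thesis
    unfolding zz cz gz by (simp add: power2_eq_square algebra_simps)
qed

section \<open>Degree counts in a bipartite graph with two disjoint edges\<close>

text \<open>The edges at \<open>i\<close> and the edges at \<open>j\<close> have only the edge \<open>(i, j)\<close> in common, and an edge that avoids
both ends belongs to neither set.\<close>

lemma edge_degree_sum_le:
  assumes fE: "finite E" and e: "(i, j) \<in> E"
  defines "R \<equiv> {p \<in> E. fst p = i}" and "C \<equiv> {p \<in> E. snd p = j}"
  shows "card R + card C \<le> card E + 1"
    and "\<lbrakk>p \<in> E; fst p \<noteq> i; snd p \<noteq> j\<rbrakk> \<Longrightarrow> card R + card C \<le> card E"
proof -
  have "R \<inter> C = {(i, j)}" using e by (auto simp: R_def C_def)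
  then have s: "card R + card C = card (R \<union> C) + 1"
    using card_Un_Int[of R C] fE by (simp add: R_def C_def)
  have sub: "R \<union> C \<subseteq> E" by (auto simp: R_def C_def)
  show "card R + card C \<le> card E + 1"
    using s card_mono[OF fE sub] by simp
  assume "p \<in> E" "fst p \<noteq> i" "snd p \<noteq> j"
  then have "R \<union> C \<subset> E" using sub by (auto simp: R_def C_def)
  then have "card (R \<union> C) < card E" by (rule psubset_card_mono[OF fE])
  with s show "card R + card C \<le> card E" by linarith
qed

lemma sum_over_pairs:
  fixes f :: "'i \<Rightarrow> 'j \<Rightarrow> real"
  assumes "finite I" "finite J" "E \<subseteq> I \<times> J"
  shows "(\<Sum>i\<in>I. \<Sum>j\<in>J. of_bool ((i, j) \<in> E) * f i j) = (\<Sum>(i, j)\<in>E. f i j)"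
proof -
  have "(\<Sum>i\<in>I. \<Sum>j\<in>J. of_bool ((i, j) \<in> E) * f i j)
      = (\<Sum>p\<in>I \<times> J. if p \<in> E then (case p of (i, j) \<Rightarrow> f i j) else 0)"
    unfolding sum.cartesian_product by (intro sum.cong refl) auto
  also have "\<dots> = (\<Sum>(i, j)\<in>E. f i j)"
    using assms by (subst sum.inter_restrict[symmetric]) (auto simp: Int_absorb1 intro!: sum.cong)
  finally show ?thesis .
qed

text \<open>The all-ones vector is the test vector because $B = J - 2N$, with $N$ the 0/1 matrix of the negative
edges, is a perturbation of the all-ones matrix $J$. With column degrees $c_j$, row degrees $d_i$,
$g_i = \sum_{j \sim i} c_j$ and
$K = \sum c_j^2$, $D = \sum d_i^2$, $H = \sum_{ij \in E} d_i c_j$, $L = \sum g_i^2$,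
expanding the squares shows that the right side exceeds the left side by
\[4r [ s(m^2 - K) + r(m - D) - 4m^2 + 4H ] + 16 (mK - L).\]
Here $L \le mK$ since $g_i \le m$, and $H \ge K + D - m$ since
$\sum_{ij \in E} (d_i - 1)(c_j - 1) \ge 0$. The bracket is therefore at least
$(s - 4)(m^2 - K - D + m) + (s - r)(D - m)$, in which $m^2 - K - D + m$ counts the ordered pairs of
disjoint edges. The left side is $r$ times the value that the star achieves; see \<open>star_eigenvalue\<close>.\<close>

lemma disjoint_edges_bound:
  fixes I :: "'i set" and J :: "'j set" and E :: "('i \<times> 'j) set"
  assumes finI: "finite I" and finJ: "finite J" and E: "E \<subseteq> I \<times> J"
    and pE: "p \<in> E" and qE: "q \<in> E" and pq: "fst p \<noteq> fst q" "snd p \<noteq> snd q"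
    and rs: "card I \<le> card J" and s4: "4 < card J"
  defines "B \<equiv> \<lambda>i j. 1 - 2 * of_bool ((i, j) \<in> E) :: real"
    and "r \<equiv> real (card I)" and "s \<equiv> real (card J)" and "m \<equiv> real (card E)"
  shows "r * (4 * m * (r - m) * (s - 1))
    < r * s * (\<Sum>j\<in>J. (col_prod I B (\<lambda>_. 1) j)\<^sup>2) - (\<Sum>i\<in>I. (gram I J B (\<lambda>_. 1) i)\<^sup>2)"
proof -
  define N :: "'i \<Rightarrow> 'j \<Rightarrow> real" where "N = (\<lambda>i j. of_bool ((i, j) \<in> E))"
  define c where "c = (\<lambda>j. \<Sum>i\<in>I. N i j)"
  define d where "d = (\<lambda>i. \<Sum>j\<in>J. N i j)"
  define g where "g = (\<lambda>i. \<Sum>j\<in>J. N i j * c j)"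
  define K where "K = (\<Sum>j\<in>J. (c j)\<^sup>2)"
  define D where "D = (\<Sum>i\<in>I. (d i)\<^sup>2)"
  define H where "H = (\<Sum>i\<in>I. d i * g i)"
  define L where "L = (\<Sum>i\<in>I. (g i)\<^sup>2)"
  have fE: "finite E" using finite_subset[OF E] finI finJ by simp
  have edge_sum: "(\<Sum>i\<in>I. \<Sum>j\<in>J. N i j * f i j) = (\<Sum>(i, j)\<in>E. f i j)" for f :: "'i \<Rightarrow> 'j \<Rightarrow> real"
    unfolding N_def by (rule sum_over_pairs[OF finI finJ E])
  have c_card: "c j = real (card {p \<in> E. snd p = j})" for j
  proof -
    have "c j = (\<Sum>i\<in>{i \<in> I. (i, j) \<in> E}. 1)"
      unfolding c_def N_def using finI by (simp add: of_bool_def sum.inter_filter[symmetric])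
    also have "\<dots> = real (card {i \<in> I. (i, j) \<in> E})" by simp
    also have "card {i \<in> I. (i, j) \<in> E} = card ((\<lambda>i. (i, j)) ` {i \<in> I. (i, j) \<in> E})"
      by (rule card_image[symmetric]) (auto simp: inj_on_def)
    also have "(\<lambda>i. (i, j)) ` {i \<in> I. (i, j) \<in> E} = {p \<in> E. snd p = j}"
      using E by force
    finally show ?thesis .
  qed
  have d_card: "d i = real (card {p \<in> E. fst p = i})" for i
  proof -
    have "d i = (\<Sum>j\<in>{j \<in> J. (i, j) \<in> E}. 1)"
      unfolding d_def N_def using finJ by (simp add: of_bool_def sum.inter_filter[symmetric])
    also have "\<dots> = real (card {j \<in> J. (i, j) \<in> E})" by simp
    also have "card {j \<in> J. (i, j) \<in> E} = card (Pair i ` {j \<in> J. (i, j) \<in> E})"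
      by (rule card_image[symmetric]) (auto simp: inj_on_def)
    also have "Pair i ` {j \<in> J. (i, j) \<in> E} = {p \<in> E. fst p = i}"
      using E by force
    finally show ?thesis .
  qed
  have sum_d: "(\<Sum>i\<in>I. d i) = m"
    using edge_sum[of "\<lambda>_ _. 1"] by (simp add: d_def m_def)
  have sum_c: "(\<Sum>j\<in>J. c j) = m"
    using sum_d unfolding c_def d_def by (subst sum.swap)
  have K_edges: "K = (\<Sum>(i, j)\<in>E. c j)"
  proof -
    have "K = (\<Sum>j\<in>J. \<Sum>i\<in>I. N i j * c j)"
      by (simp add: K_def power2_eq_square sum_distrib_right[symmetric] c_def)
    also have "\<dots> = (\<Sum>i\<in>I. \<Sum>j\<in>J. N i j * c j)" by (rule sum.swap)
    finally show ?thesis by (simp only: edge_sum)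
  qed
  have sum_g: "(\<Sum>i\<in>I. g i) = K"
    by (simp only: g_def K_edges edge_sum)
  have D_edges: "D = (\<Sum>(i, j)\<in>E. d i)"
  proof -
    have "D = (\<Sum>i\<in>I. \<Sum>j\<in>J. N i j * d i)"
      by (simp add: D_def power2_eq_square sum_distrib_right[symmetric] d_def)
    then show ?thesis by (simp only: edge_sum)
  qed
  have H_edges: "H = (\<Sum>(i, j)\<in>E. d i * c j)"
  proof -
    have "H = (\<Sum>i\<in>I. \<Sum>j\<in>J. N i j * (d i * c j))"
      by (simp add: H_def g_def sum_distrib_left mult_ac)
    then show ?thesis by (simp only: edge_sum)
  qed
  have m_edges: "m = (\<Sum>(i, j)\<in>E. 1)"
    by (simp add: m_def)
  have d1: "1 \<le> d i" and c1: "1 \<le> c j" if "(i, j) \<in> E" for i j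
  proof -
    have "{p \<in> E. fst p = i} \<noteq> {}" "{p \<in> E. snd p = j} \<noteq> {}" using that by auto
    then have "0 < card {p \<in> E. fst p = i}" "0 < card {p \<in> E. snd p = j}"
      using fE by (simp_all add: card_gt_0_iff)
    then show "1 \<le> d i" "1 \<le> c j" unfolding d_card c_card by linarith+
  qed
  have Dm: "m \<le> D"
    unfolding D_edges m_edges by (intro sum_mono) (auto simp: d1)
  have HKD: "K + D - m \<le> H"
  proof -
    have "0 \<le> (\<Sum>(i, j)\<in>E. (d i - 1) * (c j - 1))"
      by (intro sum_nonneg) (auto simp: d1 c1)
    also have "\<dots> = H - K - D + m"
      unfolding H_edges K_edges D_edges m_edges
      by (simp add: sum_subtractf[symmetric] sum.distrib[symmetric] case_prod_beta algebra_simps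
          del: sum_constant)
    finally show ?thesis by simp
  qed
  have LmK: "L \<le> m * K"
  proof -
    have c0: "0 \<le> c j" for j unfolding c_card by simp
    have g0: "0 \<le> g i" for i unfolding g_def N_def using c0 by (intro sum_nonneg) auto
    have "g i \<le> m" for i
      unfolding g_def sum_c[symmetric] N_def using c0 by (intro sum_mono) auto
    then have "L \<le> (\<Sum>i\<in>I. m * g i)"
      unfolding L_def power2_eq_square using g0 by (intro sum_mono mult_right_mono) auto
    then show ?thesis by (simp add: sum_distrib_left[symmetric] sum_g)
  qed
  \<comment> \<open>summing over an edge \<open>(a, b)\<close> the number \<open>m - c b - d a + 1\<close> of edges disjoint from it\<close>
  have pos: "0 < m\<^sup>2 - K - D + m"
  proof -
    obtain i j where p: "p = (i, j)" by (cases p)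
    have deg: "card {p \<in> E. fst p = a} + card {p \<in> E. snd p = b} \<le> card E + 1"
      if "(a, b) \<in> E" for a b
      by (rule edge_degree_sum_le(1)[OF fE that])
    have strict: "card {p \<in> E. fst p = i} + card {p \<in> E. snd p = j} \<le> card E"
      using pE qE pq unfolding p by (intro edge_degree_sum_le(2)[OF fE, of i j q]) auto
    have le: "0 \<le> m - c b - d a + 1" if "(a, b) \<in> E" for a b
      using deg[OF that] unfolding c_card d_card m_def by linarith
    have lt: "0 < m - c j - d i + 1"
      using strict unfolding c_card d_card m_def by linarith
    have "0 < (\<Sum>(a, b)\<in>E. m - c b - d a + 1)"
      using lt le pE p by (intro sum_pos2[OF fE, of p]) auto
    also have "\<dots> = m\<^sup>2 - K - D + m"
      unfolding K_edges D_edges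
      by (simp add: sum_subtractf sum.distrib case_prod_beta power2_eq_square m_def)
    finally show ?thesis .
  qed
  have cp: "col_prod I B (\<lambda>_. 1) j = r - 2 * c j" for j
    by (simp add: col_prod_def B_def c_def N_def r_def sum_subtractf sum_distrib_left)
  have gr: "gram I J B (\<lambda>_. 1) i = (r * s - 2 * m) - 2 * r * d i + 4 * g i" for i
  proof -
    have "gram I J B (\<lambda>_. 1) i
        = (\<Sum>j\<in>J. r - 2 * c j - 2 * r * N i j + 4 * (N i j * c j))"
      unfolding gram_def cp by (intro sum.cong refl) (simp add: B_def N_def algebra_simps)
    then show ?thesis
      by (simp add: sum_subtractf sum.distrib sum_distrib_left[symmetric] sum_c d_def g_def s_def)
  qed
  have cp_sq: "(\<Sum>j\<in>J. (col_prod I B (\<lambda>_. 1) j)\<^sup>2) = r\<^sup>2 * s - 4 * r * m + 4 * K"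
  proof -
    have "(\<Sum>j\<in>J. (col_prod I B (\<lambda>_. 1) j)\<^sup>2) = (\<Sum>j\<in>J. r\<^sup>2 - 4 * r * c j + 4 * (c j)\<^sup>2)"
      unfolding cp by (intro sum.cong refl) (simp add: power2_eq_square algebra_simps)
    then show ?thesis
      by (simp add: sum_subtractf sum.distrib sum_distrib_left[symmetric] sum_c K_def s_def)
  qed
  have gr_sq: "(\<Sum>i\<in>I. (gram I J B (\<lambda>_. 1) i)\<^sup>2) = r * (r * s - 2 * m)\<^sup>2 + 4 * r\<^sup>2 * D + 16 * L
      - 4 * r * (r * s - 2 * m) * m + 8 * (r * s - 2 * m) * K - 16 * r * H"
  proof -
    define a where "a = r * s - 2 * m"
    have "(\<Sum>i\<in>I. (gram I J B (\<lambda>_. 1) i)\<^sup>2) = (\<Sum>i\<in>I. a\<^sup>2 + 4 * r\<^sup>2 * (d i)\<^sup>2 + 16 * (g i)\<^sup>2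
        - 4 * r * a * d i + 8 * a * g i - 16 * r * (d i * g i))"
      unfolding gr a_def[symmetric]
      by (intro sum.cong refl) (simp add: power2_eq_square algebra_simps)
    also have "\<dots> = r * a\<^sup>2 + 4 * r\<^sup>2 * D + 16 * L - 4 * r * a * m + 8 * a * K - 16 * r * H"
      by (simp add: sum_subtractf sum.distrib sum_distrib_left[symmetric] sum_d sum_g
          D_def H_def L_def r_def)
    finally show ?thesis by (simp only: a_def)
  qed
  have r0: "0 < r"
    using pE E finI unfolding r_def by (auto simp: card_gt_0_iff)
  have "0 < (s - 4) * (m\<^sup>2 - K - D + m)"
    using pos s4 unfolding s_def by (intro mult_pos_pos) auto
  moreover have "0 \<le> (s - r) * (D - m)"
    using Dm rs unfolding r_def s_def by (intro mult_nonneg_nonneg) auto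
  ultimately have "0 < (s - 4) * (m\<^sup>2 - K - D + m) + (s - r) * (D - m)"
    by (rule add_pos_nonneg)
  also have "\<dots> \<le> s * (m\<^sup>2 - K) + r * (m - D) - 4 * m\<^sup>2 + 4 * H"
    using HKD by (simp add: algebra_simps)
  finally have "0 < 4 * r * (s * (m\<^sup>2 - K) + r * (m - D) - 4 * m\<^sup>2 + 4 * H) + 16 * (m * K - L)"
    using r0 LmK by (intro add_pos_nonneg) auto
  also have "\<dots> = r * s * (r\<^sup>2 * s - 4 * r * m + 4 * K)
      - (r * (r * s - 2 * m)\<^sup>2 + 4 * r\<^sup>2 * D + 16 * L
        - 4 * r * (r * s - 2 * m) * m + 8 * (r * s - 2 * m) * K - 16 * r * H)
      - r * (4 * m * (r - m) * (s - 1))"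
    by (simp add: power2_eq_square field_simps)
  finally show ?thesis
    unfolding cp_sq gr_sq by (rule diff_gt_0_iff_gt[THEN iffD1])
qed

section \<open>Eigenvalues of signed complete bipartite graphs\<close>

text \<open>The maximum of an empty set is an arbitrary value, so the index is meaningful only because a real
symmetric matrix has a real eigenvalue: it has a complex one, which is real because the Hermitian
form $v^* A v$ is, and it is then a root of the real characteristic polynomial.\<close>

lemma real_symmetric_has_eigenvalue:
  fixes A :: "real mat"
  assumes A: "A \<in> carrier_mat n n" and n: "0 < n"
    and sym: "\<And>i j. \<lbrakk>i < n; j < n\<rbrakk> \<Longrightarrow> A $$ (i, j) = A $$ (j, i)"
  shows "spectrum A \<noteq> {}"
proof -
  define C where "C = map_mat complex_of_real A"
  have C: "C \<in> carrier_mat n n" using A by (simp add: C_def)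
  have Cij: "C $$ (i, j) = complex_of_real (A $$ (i, j))" if "i < n" "j < n" for i j
    using that A by (simp add: C_def)
  obtain k where k: "eigenvalue C k"
    using spectrum_non_empty[OF C] n unfolding spectrum_def by auto
  then obtain v where v: "v \<in> carrier_vec n" "v \<noteq> 0\<^sub>v n" "C *\<^sub>v v = k \<cdot>\<^sub>v v"
    using C unfolding eigenvalue_def eigenvector_def by auto
  have row: "(\<Sum>j<n. C $$ (i, j) * v $ j) = k * v $ i" if "i < n" for i
  proof -
    have "(C *\<^sub>v v) $ i = (\<Sum>j<n. C $$ (i, j) * v $ j)"
      using that v(1) C by (simp add: scalar_prod_def row_def atLeast0LessThan)
    then show ?thesis using v that by simp
  qed
  define Q where "Q = (\<Sum>i<n. \<Sum>j<n. cnj (v $ i) * (C $$ (i, j) * v $ j))"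
  define P where "P = (\<Sum>i<n. (cmod (v $ i))\<^sup>2)"
  have Q: "Q = k * complex_of_real P"
  proof -
    have "Q = (\<Sum>i<n. cnj (v $ i) * (k * v $ i))"
      unfolding Q_def by (intro sum.cong refl) (simp add: sum_distrib_left[symmetric] row)
    also have "\<dots> = k * (\<Sum>i<n. complex_of_real ((cmod (v $ i))\<^sup>2))"
      by (simp add: sum_distrib_left complex_norm_square mult_ac del: of_real_power)
    finally show ?thesis by (simp add: P_def)
  qed
  have "cnj Q = (\<Sum>i<n. \<Sum>j<n. v $ i * (C $$ (i, j) * cnj (v $ j)))"
    unfolding Q_def by (simp add: Cij)
  also have "\<dots> = (\<Sum>j<n. \<Sum>i<n. v $ i * (C $$ (i, j) * cnj (v $ j)))"
    by (rule sum.swap)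
  also have "\<dots> = Q"
    unfolding Q_def by (intro sum.cong refl) (simp add: Cij sym mult_ac)
  finally have "cnj k * complex_of_real P = k * complex_of_real P"
    by (simp add: Q)
  moreover have "P \<noteq> 0"
  proof
    assume "P = 0"
    then have "\<forall>i<n. v $ i = 0" by (auto simp: P_def sum_nonneg_eq_0_iff)
    then have "v = 0\<^sub>v n" using v(1) by auto
    with v(2) show False by simp
  qed
  ultimately have "cnj k = k" by simp
  then have "k = complex_of_real (Re k)"
    by (simp add: complex_eq_iff)
  moreover have "poly (char_poly C) k = 0"
    using k eigenvalue_root_char_poly[OF C] by simp
  ultimately have "poly (map_poly complex_of_real (char_poly A)) (complex_of_real (Re k)) = 0"
    using of_real_hom.char_poly_hom[OF A] unfolding C_def by metis
  then have "poly (char_poly A) (Re k) = 0" by simp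
  then show ?thesis
    using eigenvalue_root_char_poly[OF A] by (auto simp: spectrum_def)
qed

lemma sum_split_parts:
  fixes f :: "nat \<Rightarrow> real"
  shows "(\<Sum>k<r + s. f k) = (\<Sum>i<r. f i) + (\<Sum>j<s. f (r + j))"
  by (induction s) (simp_all add: algebra_simps)

text \<open>The matrix with these entries is the off-diagonal block $B$ of the adjacency matrix, so that
an eigenvector for $\theta$ is a pair $(x, y)$ with $B y = \theta x$ and $B^T x = \theta y$.\<close>

definition sign_entry :: "nat \<Rightarrow> nat signed_graph \<Rightarrow> nat \<Rightarrow> nat \<Rightarrow> real" where
  "sign_entry r S i j = of_int (sign S {i, r + j})"

lemma complete_bipartite_edge_iff:
  "{a, b} \<in> edges (complete_bipartite r s)
    \<longleftrightarrow> (a < r \<and> r \<le> b \<and> b < r + s) \<or> (b < r \<and> r \<le> a \<and> a < r + s)"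
proof
  assume "{a, b} \<in> edges (complete_bipartite r s)"
  then show "(a < r \<and> r \<le> b \<and> b < r + s) \<or> (b < r \<and> r \<le> a \<and> a < r + s)"
    by (auto simp: complete_bipartite_def doubleton_eq_iff)
next
  have mem: "{a, b} \<in> edges (complete_bipartite r s)" if "a < r" "r \<le> b" "b < r + s" for a b
  proof -
    have "b = r + (b - r)" "b - r < s" using that by auto
    then have "\<exists>a' b'. {a, b} = {a', r + b'} \<and> a' < r \<and> b' < s"
      using that(1) by (intro exI[of _ a] exI[of _ "b - r"]) simp
    then show ?thesis by (simp add: complete_bipartite_def)
  qed
  assume "(a < r \<and> r \<le> b \<and> b < r + s) \<or> (b < r \<and> r \<le> a \<and> a < r + s)"
  then show "{a, b} \<in> edges (complete_bipartite r s)"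
    using mem[of a b] mem[of b a] by (auto simp: insert_commute)
qed

lemma adjacency_matrix_bipartite:
  assumes S: "graph S = complete_bipartite r s"
  shows "adjacency_matrix S \<in> carrier_mat (r + s) (r + s)"
    and "\<lbrakk>a < r; b < r\<rbrakk> \<Longrightarrow> adjacency_matrix S $$ (a, b) = 0"
    and "\<lbrakk>i < r; j < s\<rbrakk> \<Longrightarrow> adjacency_matrix S $$ (i, r + j) = sign_entry r S i j"
    and "\<lbrakk>i < r; j < s\<rbrakk> \<Longrightarrow> adjacency_matrix S $$ (r + j, i) = sign_entry r S i j"
    and "\<lbrakk>c < s; d < s\<rbrakk> \<Longrightarrow> adjacency_matrix S $$ (r + c, r + d) = 0"
proof -
  have card: "card (verts (graph S)) = r + s"
    by (simp add: S complete_bipartite_def)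
  show "adjacency_matrix S \<in> carrier_mat (r + s) (r + s)"
    by (simp add: adjacency_matrix_def Let_def card)
  show "\<lbrakk>a < r; b < r\<rbrakk> \<Longrightarrow> adjacency_matrix S $$ (a, b) = 0"
    "\<lbrakk>i < r; j < s\<rbrakk> \<Longrightarrow> adjacency_matrix S $$ (i, r + j) = sign_entry r S i j"
    "\<lbrakk>i < r; j < s\<rbrakk> \<Longrightarrow> adjacency_matrix S $$ (r + j, i) = sign_entry r S i j"
    "\<lbrakk>c < s; d < s\<rbrakk> \<Longrightarrow> adjacency_matrix S $$ (r + c, r + d) = 0"
    unfolding adjacency_matrix_def Let_def card
    by (simp_all add: S complete_bipartite_edge_iff sign_entry_def insert_commute[of "r + j" i])
qed

lemma adjacency_mult_vec:
  assumes S: "graph S = complete_bipartite r s" and v: "v \<in> carrier_vec (r + s)"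
  shows "i < r \<Longrightarrow> (adjacency_matrix S *\<^sub>v v) $ i = (\<Sum>j<s. sign_entry r S i j * v $ (r + j))"
    and "j < s \<Longrightarrow> (adjacency_matrix S *\<^sub>v v) $ (r + j) = (\<Sum>i<r. sign_entry r S i j * v $ i)"
proof -
  note A = adjacency_matrix_bipartite[OF S]
  have mult: "(adjacency_matrix S *\<^sub>v v) $ k = (\<Sum>l<r + s. adjacency_matrix S $$ (k, l) * v $ l)"
    if "k < r + s" for k
    using that v A(1) by (simp add: scalar_prod_def row_def atLeast0LessThan)
  show "i < r \<Longrightarrow> (adjacency_matrix S *\<^sub>v v) $ i = (\<Sum>j<s. sign_entry r S i j * v $ (r + j))"
    by (simp add: mult sum_split_parts A)
  show "j < s \<Longrightarrow> (adjacency_matrix S *\<^sub>v v) $ (r + j) = (\<Sum>i<r. sign_entry r S i j * v $ i)"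
    by (simp add: mult sum_split_parts A)
qed

lemma eigenvalue_adjacency_obtain:
  assumes S: "graph S = complete_bipartite r s" and ev: "eigenvalue (adjacency_matrix S) \<theta>"
  obtains x y where "\<And>i. i < r \<Longrightarrow> (\<Sum>j<s. sign_entry r S i j * y j) = \<theta> * x i"
    "\<And>j. j < s \<Longrightarrow> (\<Sum>i<r. sign_entry r S i j * x i) = \<theta> * y j"
    "(\<exists>i<r. x i \<noteq> 0) \<or> (\<exists>j<s. y j \<noteq> 0)"
proof -
  note A = adjacency_matrix_bipartite(1)[OF S]
  obtain v where v: "v \<in> carrier_vec (r + s)" "v \<noteq> 0\<^sub>v (r + s)"
      "adjacency_matrix S *\<^sub>v v = \<theta> \<cdot>\<^sub>v v"
    using ev A unfolding eigenvalue_def eigenvector_def by auto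
  show thesis
  proof (rule that[of "\<lambda>j. v $ (r + j)" "\<lambda>i. v $ i"])
    show "(\<Sum>j<s. sign_entry r S i j * v $ (r + j)) = \<theta> * v $ i" if "i < r" for i
      using adjacency_mult_vec(1)[OF S v(1) that] v that by simp
    show "(\<Sum>i<r. sign_entry r S i j * v $ i) = \<theta> * v $ (r + j)" if "j < s" for j
      using adjacency_mult_vec(2)[OF S v(1) that] v that by simp
    show "(\<exists>i<r. v $ i \<noteq> 0) \<or> (\<exists>j<s. v $ (r + j) \<noteq> 0)"
    proof (rule ccontr)
      assume neg: "\<not> ?thesis"
      have "v $ k = 0" if "k < r + s" for k
      proof (cases "k < r")
        case False
        have "k - r < s" using False that by arith
        then have "v $ (r + (k - r)) = 0" using neg by blast
        then show ?thesis using False by simp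
      qed (use neg in auto)
      then have "v = 0\<^sub>v (r + s)" using v(1) by auto
      with v(2) show False by simp
    qed
  qed
qed

lemma eigenvalue_adjacency_intro:
  assumes S: "graph S = complete_bipartite r s"
    and x: "\<And>i. i < r \<Longrightarrow> (\<Sum>j<s. sign_entry r S i j * y j) = \<theta> * x i"
    and y: "\<And>j. j < s \<Longrightarrow> (\<Sum>i<r. sign_entry r S i j * x i) = \<theta> * y j"
    and nz: "\<exists>j<s. y j \<noteq> 0"
  shows "eigenvalue (adjacency_matrix S) \<theta>"
proof -
  note A = adjacency_matrix_bipartite(1)[OF S]
  define v where "v = vec (r + s) (\<lambda>k. if k < r then x k else y (k - r))"
  have v: "v \<in> carrier_vec (r + s)" by (simp add: v_def)
  have "adjacency_matrix S *\<^sub>v v = \<theta> \<cdot>\<^sub>v v"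
  proof (rule eq_vecI)
    fix k assume "k < dim_vec (\<theta> \<cdot>\<^sub>v v)"
    then have k: "k < r + s" by (simp add: v_def)
    show "(adjacency_matrix S *\<^sub>v v) $ k = (\<theta> \<cdot>\<^sub>v v) $ k"
    proof (cases "k < r")
      case True
      then show ?thesis using k by (simp add: adjacency_mult_vec(1)[OF S v]) (simp add: v_def x)
    next
      case False
      then have j: "k = r + (k - r)" "k - r < s" using k by auto
      then obtain j where j: "k = r + j" "j < s" by blast
      then show ?thesis by (simp add: adjacency_mult_vec(2)[OF S v]) (simp add: v_def y)
    qed
  qed (use A in \<open>simp add: v_def\<close>)
  moreover have "v \<noteq> 0\<^sub>v (r + s)"
  proof
    assume v0: "v = 0\<^sub>v (r + s)"
    obtain j where j: "j < s" "y j \<noteq> 0" using nz by blast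
    have "v $ (r + j) = y j" using j by (simp add: v_def)
    with v0 j show False by simp
  qed
  ultimately show ?thesis
    using A v unfolding eigenvalue_def eigenvector_def by auto
qed

lemma index_bipartite:
  assumes S: "graph S = complete_bipartite r s" and "0 < r + s"
  shows "eigenvalue (adjacency_matrix S) (index S)"
    and "eigenvalue (adjacency_matrix S) \<theta> \<Longrightarrow> \<theta> \<le> index S"
proof -
  note A = adjacency_matrix_bipartite[OF S]
  have fin: "finite (spectrum (adjacency_matrix S))"
    by (rule card_finite_spectrum(1)[OF A(1)])
  have "adjacency_matrix S $$ (a, b) = adjacency_matrix S $$ (b, a)"
    if "a < r + s" "b < r + s" for a b
  proof -
    have "card (verts (graph S)) = r + s" by (simp add: S complete_bipartite_def)
    then show ?thesis using that by (simp add: adjacency_matrix_def Let_def insert_commute)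
  qed
  then have "spectrum (adjacency_matrix S) \<noteq> {}"
    using real_symmetric_has_eigenvalue[OF A(1)] assms(2) by blast
  then have "index S \<in> spectrum (adjacency_matrix S)"
    unfolding index_def using fin by (rule Max_in[rotated])
  then show "eigenvalue (adjacency_matrix S) (index S)" by (simp add: spectrum_def)
  show "\<theta> \<le> index S" if "eigenvalue (adjacency_matrix S) \<theta>"
    unfolding index_def using fin that by (intro Max_ge) (auto simp: spectrum_def)
qed

section \<open>The star signing and its index\<close>

definition star_signing :: "nat \<Rightarrow> nat \<Rightarrow> nat \<Rightarrow> nat signed_graph" where
  "star_signing r s m = \<lparr>graph = complete_bipartite r s,
     sign = (\<lambda>e. if e \<in> edges (double_star r m 1) then -1 else 1)\<rparr>"

lemma star_edge_iff:
  assumes "1 \<le> m" "m \<le> r"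
  shows "{u, v} \<in> edges (double_star r m 1) \<longleftrightarrow> (u = r \<and> v < m) \<or> (v = r \<and> u < m)"
proof
  assume "{u, v} \<in> edges (double_star r m 1)"
  then show "(u = r \<and> v < m) \<or> (v = r \<and> u < m)"
    using assms by (auto simp: double_star_def doubleton_eq_iff)
next
  assume "(u = r \<and> v < m) \<or> (v = r \<and> u < m)"
  then show "{u, v} \<in> edges (double_star r m 1)"
    by (auto simp: double_star_def insert_commute)
qed

lemma star_edges:
  assumes "1 \<le> m"
  shows "edges (double_star r m 1) = (\<lambda>a. {a, r}) ` {..<m}"
  using assms by (auto simp: double_star_def)

lemma is_tree_star:
  assumes m: "1 \<le> m" "m \<le> r"
  shows "is_tree (double_star r m 1)"
proof -
  let ?G = "double_star r m 1"
  let ?R = "{(x, y). {x, y} \<in> edges ?G}"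
  have V: "verts ?G = {..<m} \<union> {r}" by (auto simp: double_star_def)
  have "simple_graph ?G"
    unfolding simple_graph_def V star_edges[OF m(1)] using m by auto
  moreover have "connected_graph ?G"
  proof -
    have inward: "(u, r) \<in> ?R\<^sup>*" and outward: "(r, u) \<in> ?R\<^sup>*" if "u \<in> verts ?G" for u
      using that unfolding V by (auto simp: star_edge_iff[OF m, simplified] intro: r_into_rtrancl)
    have "(u, v) \<in> ?R\<^sup>*" if "u \<in> verts ?G" "v \<in> verts ?G" for u v
      using inward[OF that(1)] outward[OF that(2)] by (rule rtrancl_trans)
    then show ?thesis unfolding connected_graph_def using V by blast
  qed
  moreover have "\<not> is_cycle ?G c" for c
  proof
    assume c: "is_cycle ?G c"
    then have len: "3 \<le> length c" and dist: "distinct c"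
      and e: "\<And>i. i < length c \<Longrightarrow> {c ! i, c ! (Suc i mod length c)} \<in> edges ?G"
      by (auto simp: is_cycle_def)
    have inj: "c ! i = r \<Longrightarrow> c ! j = r \<Longrightarrow> i = j" if "i < length c" "j < length c" for i j
      using nth_eq_iff_index_eq[OF dist that] by simp
    have centre: "c ! i = r \<or> c ! (Suc i mod length c) = r" if "i < length c" for i
      using e[OF that] unfolding star_edge_iff[OF m] by blast
    have ne: "c \<noteq> []" using len by auto
    \<comment> \<open>every edge contains the centre, so among consecutive vertices of a cycle one is the centre\<close>
    then have "c ! 0 = r \<or> c ! 1 = r" "c ! 1 = r \<or> c ! 2 = r"
      using centre[of 0] centre[of 1] len by (auto simp: numeral_2_eq_2)
    moreover have "\<not> (c ! 0 = r \<and> c ! 2 = r)"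
      using inj[of 0 2] len ne by auto
    ultimately have c1: "c ! 1 = r" by blast
    have "c ! 2 \<noteq> r" using inj[of 1 2] len c1 by auto
    then have "c ! (3 mod length c) = r"
      using centre[of 2] len by (simp add: numeral_3_eq_3 numeral_2_eq_2)
    moreover have lt: "3 mod length c < length c" by (rule mod_less_divisor) (use len in linarith)
    ultimately have "3 mod length c = 1"
      using inj[OF lt, of 1] len c1 by simp
    moreover have "3 mod length c \<noteq> 1"
      using len by (cases "length c = 3") auto
    ultimately show False by simp
  qed
  ultimately show ?thesis unfolding is_tree_def by blast
qed

lemma negative_subgraph_star:
  assumes m: "1 \<le> m" "m \<le> r" and s: "1 \<le> s"
  shows "negative_subgraph (star_signing r s m) = double_star r m 1"
proof -
  have "edges (double_star r m 1) \<subseteq> edges (complete_bipartite r s)"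
    unfolding star_edges[OF m(1)] using m s by (auto simp: complete_bipartite_edge_iff)
  then have N: "{e \<in> edges (graph (star_signing r s m)). sign (star_signing r s m) e = -1}
      = edges (double_star r m 1)"
    by (auto simp: star_signing_def)
  have "\<Union> (edges (double_star r m 1)) = verts (double_star r m 1)"
    unfolding star_edges[OF m(1)] using m by (auto simp: double_star_def intro!: exI[of _ 0])
  then show ?thesis
    unfolding negative_subgraph_def N Let_def by simp
qed

lemma star_signing_in_KT:
  assumes m: "1 \<le> m" "m \<le> r" and s: "1 \<le> s"
  shows "star_signing r s m \<in> KT r s m"
proof -
  have "is_signed_graph (star_signing r s m)"
    by (auto simp: is_signed_graph_def star_signing_def simple_graph_def complete_bipartite_def)
  moreover have "card (edges (double_star r m 1)) = m"
  proof -
    have "inj_on (\<lambda>a. {a, r}) {..<m}" by (auto simp: inj_on_def doubleton_eq_iff)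
    then show ?thesis unfolding star_edges[OF m(1)] by (simp add: card_image)
  qed
  ultimately show ?thesis
    unfolding KT_def using is_tree_star[OF m] negative_subgraph_star[OF m s]
    by (simp add: star_signing_def)
qed

lemma star_sign_entry:
  assumes m: "1 \<le> m" "m \<le> r" and "i < r"
  shows "sign_entry r (star_signing r s m) i j = (if j = 0 \<and> i < m then -1 else 1)"
proof -
  have "{i, r + j} \<in> edges (double_star r m 1) \<longleftrightarrow> j = 0 \<and> i < m"
    unfolding star_edge_iff[OF m] using assms by auto
  then show ?thesis by (simp add: sign_entry_def star_signing_def)
qed

text \<open>For the star, $B B^T$ has rank 2, with trace $rs$ and second elementary symmetric function
$4m(r - m)(s - 1)$ of the eigenvalues, so its largest eigenvalue is the larger root of
$\mu^2 - rs \mu + 4m(r - m)(s - 1)$. In the eigenvector, $y$ equals \<open>p\<close> at the centre $w_1$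
and \<open>q\<close> elsewhere, and $x = B y / \theta$.\<close>

lemma star_eigenvalue:
  assumes m: "1 \<le> m" "2 * m < r" and s: "2 \<le> s"
  obtains \<theta> where "0 < \<theta>" "eigenvalue (adjacency_matrix (star_signing r s m)) \<theta>"
    "real r * real s \<le> 2 * \<theta>\<^sup>2"
    "\<theta>\<^sup>2 * (real r * real s - \<theta>\<^sup>2) = 4 * real m * (real r - real m) * (real s - 1)"
proof -
  define R S M where "R = real r" and "S = real s" and "M = real m"
  have R: "2 * M < R" and M: "1 \<le> M" and S: "2 \<le> S"
    using m s by (auto simp: R_def S_def M_def)
  define e where "e = 4 * M * (R - M) * (S - 1)"
  define w where "w = sqrt ((R * S)\<^sup>2 - 4 * e)"
  have "(R * S)\<^sup>2 - 4 * e = R\<^sup>2 * (S - 2)\<^sup>2 + 4 * (S - 1) * (R - 2 * M)\<^sup>2"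
    unfolding e_def by (simp add: power2_eq_square algebra_simps)
  \<comment> \<open>this rewriting shows that the discriminant of the quadratic is nonnegative\<close>
  also have "\<dots> \<ge> 0" using S by simp
  finally have disc: "w\<^sup>2 = (R * S)\<^sup>2 - 4 * e" and w0: "0 \<le> w"
    unfolding w_def by simp_all
  define l where "l = (R * S + w) / 2"
  have RS: "0 < R * S" using R M S by simp
  then have l0: "0 < l" and l2: "R * S \<le> 2 * l" using w0 by (auto simp: l_def)
  have quad: "l * (R * S - l) = e"
  proof -
    have "l * (R * S - l) = ((R * S)\<^sup>2 - w\<^sup>2) / 4"
      unfolding l_def by (simp add: power2_eq_square field_simps)
    then show ?thesis by (simp add: disc)
  qed
  define \<theta> where "\<theta> = sqrt l"
  have th: "0 < \<theta>" "\<theta>\<^sup>2 = l" using l0 by (simp_all add: \<theta>_def)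
  define p where "p = (S - 1) * (R - 2 * M)"
  define q where "q = l - R"
  define y where "y = (\<lambda>j::nat. if j = 0 then p else q)"
  define x where "x = (\<lambda>i::nat. ((if i < m then -1 else 1) * p + (S - 1) * q) / \<theta>)"
  have p0: "p \<noteq> 0" using R S by (simp add: p_def)
  have entry: "sign_entry r (star_signing r s m) i j = (if j = 0 \<and> i < m then -1 else 1)"
    if "i < r" for i j
    using m that by (intro star_sign_entry) auto
  have split_col: "(\<Sum>j<s. f j) = f 0 + (S - 1) * b" if "\<And>j. 0 < j \<Longrightarrow> f j = b" for f :: "nat \<Rightarrow> real" and b
  proof -
    obtain s' where s': "s = Suc s'" using s by (cases s) auto
    have "(\<Sum>j<s. f j) = f 0 + (\<Sum>j<s'. f (Suc j))"
      unfolding s' by (rule sum.lessThan_Suc_shift)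
    then show ?thesis by (simp add: that S_def s')
  qed
  have split_row: "(\<Sum>i<r. f i) = M * a + (R - M) * b"
    if "\<And>i. i < m \<Longrightarrow> f i = a" "\<And>i. m \<le> i \<Longrightarrow> i < r \<Longrightarrow> f i = b" for f :: "nat \<Rightarrow> real" and a b
  proof -
    have "(\<Sum>i<m + (r - m). f i) = (\<Sum>i<m. f i) + (\<Sum>i<r - m. f (m + i))"
      by (rule sum_split_parts)
    moreover have "(\<Sum>i<m. f i) = M * a" by (simp add: that M_def)
    moreover have "(\<Sum>i<r - m. f (m + i)) = (R - M) * b"
      using m by (simp add: that R_def M_def of_nat_diff)
    ultimately show ?thesis using m by simp
  qed
  have "eigenvalue (adjacency_matrix (star_signing r s m)) \<theta>"
  proof (rule eigenvalue_adjacency_intro[where r = r and s = s and x = x and y = y])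
    show "graph (star_signing r s m) = complete_bipartite r s" by (simp add: star_signing_def)
    show "\<exists>j<s. y j \<noteq> 0" using s p0 by (auto simp: y_def intro!: exI[of _ 0])
  next
    fix i assume i: "i < r"
    have "(\<Sum>j<s. sign_entry r (star_signing r s m) i j * y j)
        = sign_entry r (star_signing r s m) i 0 * y 0 + (S - 1) * q"
      by (rule split_col) (simp add: entry[OF i] y_def)
    then show "(\<Sum>j<s. sign_entry r (star_signing r s m) i j * y j) = \<theta> * x i"
      using th by (simp add: entry[OF i] y_def x_def)
  next
    fix j assume j: "j < s"
    let ?a = "if j = 0 then - 1 else 1 :: real"
    have "(\<Sum>i<r. sign_entry r (star_signing r s m) i j * x i)
        = M * (?a * ((- p + (S - 1) * q) / \<theta>)) + (R - M) * ((p + (S - 1) * q) / \<theta>)"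
      using m by (intro split_row) (auto simp: entry x_def)
    also have "\<dots> = (M * (?a * (- p + (S - 1) * q)) + (R - M) * (p + (S - 1) * q)) / \<theta>"
      by (simp only: times_divide_eq_right add_divide_distrib[symmetric])
    also have "M * (?a * (- p + (S - 1) * q)) + (R - M) * (p + (S - 1) * q) = \<theta>\<^sup>2 * y j"
    proof (cases "j = 0")
      case True
      have "M * (p - (S - 1) * q) + (R - M) * (p + (S - 1) * q) = l * p"
        unfolding p_def q_def by (simp add: algebra_simps)
      with True th show ?thesis by (simp add: y_def)
    next
      case False
      have "M * (- p + (S - 1) * q) + (R - M) * (p + (S - 1) * q) - l * q = l * (R * S - l) - e"
        unfolding p_def q_def e_def by (simp add: algebra_simps)
      with False th quad show ?thesis by (simp add: y_def)
    qed
    finally show "(\<Sum>i<r. sign_entry r (star_signing r s m) i j * x i) = \<theta> * y j"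
      using th by (simp add: power2_eq_square)
  qed
  with th l2 quad show thesis
    by (intro that[of \<theta>]) (auto simp: R_def S_def M_def e_def)
qed

section \<open>Disjoint negative edges lower the index\<close>

definition negative_pairs :: "nat \<Rightarrow> nat \<Rightarrow> nat signed_graph \<Rightarrow> (nat \<times> nat) set" where
  "negative_pairs r s S = {(i, j). i < r \<and> j < s \<and> sign S {i, r + j} = -1}"

text \<open>The map $\mu \mapsto \mu (rs - \mu)$ is decreasing for $\mu \ge rs/2$. If the index of the signed
graph were at least that of the star, then \<open>gram_quadratic_bound\<close> with the all-ones vector and
\<open>disjoint_edges_bound\<close> would make $\mu (rs - \mu)$ for its squared index $\mu$ exceed the value
at the squared index of the star.\<close>

lemma index_less_star_if_disjoint_edges:
  assumes rs: "r \<le> s" and m1: "1 \<le> m" and r2m: "2 * m < r"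
    and gS: "graph S = complete_bipartite r s" and sgS: "is_signed_graph S"
    and cardE: "card (negative_pairs r s S) = m"
    and p: "p \<in> negative_pairs r s S" and q: "q \<in> negative_pairs r s S"
    and pq: "fst p \<noteq> fst q" "snd p \<noteq> snd q"
  shows "index S < index (star_signing r s m)"
proof (rule ccontr)
  assume neg: "\<not> index S < index (star_signing r s m)"
  define E where "E = negative_pairs r s S"
  have cardE: "card E = m" and pE: "p \<in> E" and qE: "q \<in> E"
    using cardE p q by (simp_all add: E_def)
  have s2: "2 \<le> s" using rs m1 r2m by linarith
  have E_sub: "E \<subseteq> {..<r} \<times> {..<s}" by (auto simp: E_def negative_pairs_def)
  then have fE: "finite E" by (rule finite_subset) simp
  define B :: "nat \<Rightarrow> nat \<Rightarrow> real" where "B = (\<lambda>i j. 1 - 2 * of_bool ((i, j) \<in> E))"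
  define \<theta> where "\<theta> = index S"
  define t where "t = real r * real s"
  define e where "e = 4 * real m * (real r - real m) * (real s - 1)"
  have entry: "sign_entry r S i j = B i j" if "i < r" "j < s" for i j
  proof -
    have "{i, r + j} \<in> edges (graph S)"
      using that by (simp add: gS complete_bipartite_edge_iff)
    then have "sign S {i, r + j} \<in> {-1, 1}"
      using sgS by (simp add: is_signed_graph_def)
    then show ?thesis using that by (auto simp: sign_entry_def B_def E_def negative_pairs_def)
  qed
  \<comment> \<open>there are at least two negative edges, and \<open>s \<ge> r > 2 * m\<close>\<close>
  have s4: "4 < s"
  proof -
    have "card {p, q} \<le> card E" using pE qE fE by (intro card_mono) auto
    moreover have "p \<noteq> q" using pq by auto
    ultimately show ?thesis using r2m cardE rs by simp
  qed
  obtain \<theta>\<^sub>0 where th0: "0 < \<theta>\<^sub>0"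
      "eigenvalue (adjacency_matrix (star_signing r s m)) \<theta>\<^sub>0"
      "t \<le> 2 * \<theta>\<^sub>0\<^sup>2" "\<theta>\<^sub>0\<^sup>2 * (t - \<theta>\<^sub>0\<^sup>2) = e"
    using star_eigenvalue[OF m1 r2m s2] unfolding t_def e_def by blast
  have "\<theta>\<^sub>0 \<le> index (star_signing r s m)"
    using th0(2) s2 by (intro index_bipartite(2)[where r = r and s = s]) (auto simp: star_signing_def)
  also have "\<dots> \<le> \<theta>"
    unfolding \<theta>_def using neg by simp
  finally have th: "\<theta>\<^sub>0 \<le> \<theta>" .
  then have sq: "\<theta>\<^sub>0\<^sup>2 \<le> \<theta>\<^sup>2" using th0(1) by (intro power_mono) auto
  have big: "t \<le> 2 * \<theta>\<^sup>2" using sq th0(3) by linarith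
  have "eigenvalue (adjacency_matrix S) \<theta>"
    unfolding \<theta>_def using s2 by (intro index_bipartite(1)[OF gS]) auto
  then obtain x y where x: "\<And>i. i < r \<Longrightarrow> (\<Sum>j<s. sign_entry r S i j * y j) = \<theta> * x i"
    and y: "\<And>j. j < s \<Longrightarrow> (\<Sum>i<r. sign_entry r S i j * x i) = \<theta> * y j"
    and nz: "(\<exists>i<r. x i \<noteq> 0) \<or> (\<exists>j<s. y j \<noteq> 0)"
    by (rule eigenvalue_adjacency_obtain[OF gS]) blast
  have cp: "col_prod {..<r} B x j = \<theta> * y j" if "j < s" for j
    unfolding col_prod_def y[OF that, symmetric] using that by (intro sum.cong) (auto simp: entry)
  have gram: "gram {..<r} {..<s} B x i = \<theta>\<^sup>2 * x i" if "i \<in> {..<r}" for i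
  proof -
    have "gram {..<r} {..<s} B x i = (\<Sum>j<s. \<theta> * (sign_entry r S i j * y j))"
      unfolding gram_def using that by (intro sum.cong) (auto simp: entry cp)
    then show ?thesis
      using that by (simp add: sum_distrib_left[symmetric] x power2_eq_square)
  qed
  have "\<exists>i<r. x i \<noteq> 0"
  proof (rule ccontr)
    assume x0: "\<not> ?thesis"
    have "y j = 0" if "j < s" for j
      using y[OF that] x0 th th0(1) by simp
    with x0 nz show False by blast
  qed
  then have xpos: "0 < (\<Sum>i<r. (x i)\<^sup>2)"
    by (auto intro: sum_pos2)
  have tB: "t = (\<Sum>j<s. \<Sum>i<r. (B i j)\<^sup>2)"
  proof -
    have "(B i j)\<^sup>2 = 1" for i j by (simp add: B_def)
    then show ?thesis by (simp add: t_def)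
  qed
  have "real r * e < t * (\<Sum>j<s. (col_prod {..<r} B (\<lambda>_. 1) j)\<^sup>2)
      - (\<Sum>i<r. (gram {..<r} {..<s} B (\<lambda>_. 1) i)\<^sup>2)"
    using disjoint_edges_bound[OF _ _ E_sub pE qE pq] rs s4
    by (simp add: B_def t_def e_def cardE)
  also have "\<dots> \<le> \<theta>\<^sup>2 * (t - \<theta>\<^sup>2) * (\<Sum>i<r. 1\<^sup>2)"
    by (rule gram_quadratic_bound[OF _ gram xpos tB big]) auto
  finally have "real r * e < real r * (\<theta>\<^sup>2 * (t - \<theta>\<^sup>2))"
    by (simp add: mult_ac)
  then have "e < \<theta>\<^sup>2 * (t - \<theta>\<^sup>2)"
    using r2m by (simp add: mult_less_cancel_left_pos)
  moreover have "0 \<le> (\<theta>\<^sup>2 - \<theta>\<^sub>0\<^sup>2) * (\<theta>\<^sup>2 + \<theta>\<^sub>0\<^sup>2 - t)"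
    using sq big th0(3) by (intro mult_nonneg_nonneg) auto
  then have "\<theta>\<^sup>2 * (t - \<theta>\<^sup>2) \<le> \<theta>\<^sub>0\<^sup>2 * (t - \<theta>\<^sub>0\<^sup>2)"
    by (simp add: algebra_simps)
  ultimately show False using th0(4) by simp
qed

section \<open>Recognising a star\<close>

text \<open>Two edges with different first components share the second one, and an edge that meets both of them
without containing it would need two different first components.\<close>

lemma pairwise_meeting_pairs:
  assumes "E \<noteq> {}" and meet: "\<And>p q. \<lbrakk>p \<in> E; q \<in> E\<rbrakk> \<Longrightarrow> fst p = fst q \<or> snd p = snd q"
  shows "(\<exists>i. \<forall>p\<in>E. fst p = i) \<or> (\<exists>j. \<forall>p\<in>E. snd p = j)"
proof (cases "\<exists>i. \<forall>p\<in>E. fst p = i")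
  case False
  obtain p where p: "p \<in> E" using assms(1) by blast
  then obtain q where q: "q \<in> E" "fst q \<noteq> fst p" using False by blast
  then have "snd q = snd p" using meet[OF q(1) p] by blast
  then have "\<forall>e\<in>E. snd e = snd p" using meet[OF _ p] meet[OF _ q(1)] q(2) by metis
  then show ?thesis by blast
qed blast

lemma graph_iso_star:
  assumes L: "finite L" "c \<notin> L" "card L = m" and m: "1 \<le> m" "m \<le> r"
    and E: "edges G = (\<lambda>a. {a, c}) ` L" and V: "verts G = insert c L"
  shows "graph_iso G (double_star r m 1)"
proof -
  obtain h where h: "bij_betw h L {..<m}"
    using ex_bij_betw_finite_nat[OF L(1)] L(3) by (auto simp: atLeast0LessThan)
  define f where "f = (\<lambda>u. if u = c then r else h u)"
  have "bij_betw f L {..<m}"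
    using h L(2) by (subst bij_betw_cong[of L f h]) (auto simp: f_def)
  moreover have "bij_betw f {c} {r}" by (simp add: f_def bij_betw_def)
  ultimately have "bij_betw f (L \<union> {c}) ({..<m} \<union> {r})"
    using m by (intro bij_betw_combine) auto
  moreover have "verts (double_star r m 1) = {..<m} \<union> {r}"
    by (auto simp: double_star_def)
  ultimately have bij: "bij_betw f (verts G) (verts (double_star r m 1))"
    by (simp add: V)
  have edge: "{u, v} \<in> edges G \<longleftrightarrow> (u = c \<and> v \<in> L) \<or> (v = c \<and> u \<in> L)" for u v
    unfolding E by (auto simp: doubleton_eq_iff)
  have "{u, v} \<in> edges G \<longleftrightarrow> {f u, f v} \<in> edges (double_star r m 1)"
    if "u \<in> verts G" "v \<in> verts G" for u v
  proof -
    have mem: "a \<in> L \<and> h a < m" if "a \<noteq> c" "a \<in> verts G" for a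
      using that h by (auto simp: V bij_betw_def)
    show ?thesis
      unfolding edge star_edge_iff[OF m]
      using mem[of u] mem[of v] that L(2) m by (auto simp: f_def)
  qed
  with bij show ?thesis unfolding graph_iso_def by blast
qed

section \<open>Maximisers of the index\<close>

theorem theorem16:
  fixes r s m :: nat and S :: "nat signed_graph"
  assumes "r \<le> s" and "1 \<le> m" and "real m < real r / 2"
    and "S \<in> KT r s m"
    and "\<And>S'. S' \<in> KT r s m \<Longrightarrow> index S' \<le> index S"
  shows "graph_iso (negative_subgraph S) (double_star r m 1)"
proof -
  define E where "E = negative_pairs r s S"
  have r2m: "2 * m < r" and m_le: "m \<le> r" and s2: "2 \<le> s" using assms(1-3) by linarith+
  have gS: "graph S = complete_bipartite r s" and sgS: "is_signed_graph S"
    and cardN: "card (edges (negative_subgraph S)) = m"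
    using assms(4) by (auto simp: KT_def)
  have E_sub: "E \<subseteq> {..<r} \<times> {..<s}" by (auto simp: E_def negative_pairs_def)
  then have fE: "finite E" by (rule finite_subset) simp
  have N: "edges (negative_subgraph S) = (\<lambda>(i, j). {i, r + j}) ` E"
    by (auto simp: negative_subgraph_def Let_def gS E_def negative_pairs_def complete_bipartite_def)
  have VN: "verts (negative_subgraph S) = \<Union> (edges (negative_subgraph S))"
    by (simp add: negative_subgraph_def Let_def)
  have cardE: "card E = m"
  proof -
    have "inj_on (\<lambda>(i, j). {i, r + j}) E"
      by (auto simp: inj_on_def E_def negative_pairs_def doubleton_eq_iff)
    then show ?thesis using cardN unfolding N by (simp add: card_image)
  qed
  have meet: "fst p = fst q \<or> snd p = snd q" if pE: "p \<in> E" and qE: "q \<in> E" for p q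
  proof (rule ccontr)
    assume "\<not> (fst p = fst q \<or> snd p = snd q)"
    then have "index S < index (star_signing r s m)"
      using index_less_star_if_disjoint_edges[OF assms(1,2) r2m gS sgS] pE qE cardE
      by (simp add: E_def)
    also have "\<dots> \<le> index S"
      using assms(2) m_le s2 by (intro assms(5) star_signing_in_KT) auto
    finally show False by simp
  qed
  have "E \<noteq> {}" using cardE assms(2) by auto
  have "(\<exists>i. \<forall>p\<in>E. fst p = i) \<or> (\<exists>j. \<forall>p\<in>E. snd p = j)"
    by (rule pairwise_meeting_pairs[OF \<open>E \<noteq> {}\<close>]) (rule meet)
  then obtain c L where cL: "finite L" "c \<notin> L" "card L = m"
    "edges (negative_subgraph S) = (\<lambda>a. {a, c}) ` L"
  proof (elim disjE exE)
    fix i assume i: "\<forall>p\<in>E. fst p = i"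
    define L where "L = (\<lambda>p. r + snd p) ` E"
    have "inj_on (\<lambda>p. r + snd p) E" using i by (intro inj_onI prod_eqI) auto
    then have "card L = m" by (simp add: L_def card_image cardE)
    moreover have "i \<notin> L" using i \<open>E \<noteq> {}\<close> by (auto simp: L_def E_def negative_pairs_def)
    moreover have "edges (negative_subgraph S) = (\<lambda>a. {a, i}) ` L"
      unfolding N L_def image_image using i by (intro image_cong refl) auto
    ultimately show thesis using fE by (intro that[of L i]) (auto simp: L_def)
  next
    fix j assume j: "\<forall>p\<in>E. snd p = j"
    define L where "L = fst ` E"
    have "inj_on fst E" using j by (intro inj_onI prod_eqI) auto
    then have "card L = m" by (simp add: L_def card_image cardE)
    moreover have "r + j \<notin> L" by (auto simp: L_def E_def negative_pairs_def)
    moreover have "edges (negative_subgraph S) = (\<lambda>a. {a, r + j}) ` L"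
      unfolding N L_def image_image using j by (intro image_cong refl) auto
    ultimately show thesis using fE by (intro that[of L "r + j"]) (auto simp: L_def)
  qed
  moreover have "verts (negative_subgraph S) = insert c L"
  proof -
    have "L \<noteq> {}" using cL(3) assms(2) by auto
    then show ?thesis unfolding VN cL(4) by auto
  qed
  ultimately show ?thesis
    using assms(2) m_le by (intro graph_iso_star) auto
qed

end
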